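(* Let $n,q,s$ be positive integers with $q\ge2$, and let $C\subseteq[q]^n$ be a $(2s-1)$-design in $H(n,q)$ with degree $s$. Let $S'(C)=\{n-\partial(x,y)\mid x,y\in C,x\ne y\}=\{x_1,\ldots,x_s\}$ with $x_1<\cdots<x_s$. Then \[ \frac{(s-1)(n-s)}{q}+\frac{s(s-1)}{2}\le\sum_{i=1}^s x_i\le\frac{s(n-s)}{q}+\frac{s(s-1)}{2}, \] with equality in the left inequality if and only if $x_1=0$, and equality in the right inequality if and only if $C$ is a tight $2s$-design.
   Context: $[q]=\{1,\ldots,q\}$; $\partial$ is Hamming distance. A nonempty $C\subseteq[q]^n$ is a $t$-design in the Hamming scheme $H(n,q)$ if the array of its elements (as rows) is an orthogonal array of strength $t$: in any $t$ columns every element of $[q]^t$ occurs equally often. The degree of $C$ is $|\{\partial(x,y):x,y\in C,x\ne y\}|$. $C$ is a tight $2s$-design if it is a $2s$-design with $|C|=\sum_{k=0}^{s}\binom{n}{k}(q-1)^k$. *)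

theory Defs
  imports Complex_Main "HOL-Library.FuncSet"
begin

definition hamming_words :: "nat \<Rightarrow> nat \<Rightarrow> (nat \<Rightarrow> nat) set" where
  "hamming_words n q = {1..n} \<rightarrow>\<^sub>E {1..q}"

definition hamming_dist :: "nat \<Rightarrow> (nat \<Rightarrow> nat) \<Rightarrow> (nat \<Rightarrow> nat) \<Rightarrow> nat" where
  "hamming_dist n x y = card {i \<in> {1..n}. x i \<noteq> y i}"

text \<open>For \<open>t \<le> n\<close> this is exactly an orthogonal array of strength \<open>t\<close>: the set \<open>T\<close> is a choice of
  \<open>t\<close> columns, and an extensional function on \<open>T\<close> with values in \<open>{1..q}\<close> is an element of
  \<open>[q]\<^sup>t\<close> placed in these columns. For \<open>t > n\<close> there are no \<open>t\<close> columns; a vacuous reading would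
  make every code a design, so the condition is then imposed on all \<open>n\<close> columns. This is Delsarte's
  convention: the characteristic vector is orthogonal to every one of the first \<open>t\<close> nontrivial
  eigenspaces that exist, so for \<open>t \<ge> n\<close> only the whole space is a design.\<close>

definition hamming_design :: "nat \<Rightarrow> nat \<Rightarrow> nat \<Rightarrow> (nat \<Rightarrow> nat) set \<Rightarrow> bool" where
  "hamming_design t n q C \<longleftrightarrow>
     C \<noteq> {} \<and> C \<subseteq> hamming_words n q \<and>
     (\<forall>T. T \<subseteq> {1..n} \<and> card T = min t n \<longrightarrow>
        (\<exists>m. \<forall>z \<in> T \<rightarrow>\<^sub>E {1..q}. card {c \<in> C. restrict c T = z} = m))"

definition code_degree :: "nat \<Rightarrow> (nat \<Rightarrow> nat) set \<Rightarrow> nat" where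
  "code_degree n C = card {hamming_dist n x y | x y. x \<in> C \<and> y \<in> C \<and> x \<noteq> y}"

definition tight_even_design :: "nat \<Rightarrow> nat \<Rightarrow> nat \<Rightarrow> (nat \<Rightarrow> nat) set \<Rightarrow> bool" where
  "tight_even_design s n q C \<longleftrightarrow>
     hamming_design (2 * s) n q C \<and> card C = (\<Sum>k = 0..s. (n choose k) * (q - 1) ^ k)"

definition agreement_set :: "nat \<Rightarrow> (nat \<Rightarrow> nat) set \<Rightarrow> nat set" where
  "agreement_set n C = {n - hamming_dist n x y | x y. x \<in> C \<and> y \<in> C \<and> x \<noteq> y}"

end

theory Submission
  imports Defs
begin

text \<open>
  Put \<open>p = 1 / q\<close>, \<open>N = |C|\<close> and \<open>f(X) = \<Prod>\<^sub>i (X - x\<^sub>i)\<close>, and let \<open>X\<close> be the number of agreements of a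
  uniformly chosen pair of codewords. A strength-\<open>t\<close> design has the factorial moments of the binomial
  distribution, \<open>E (X)\<^sub>k = (n)\<^sub>k p\<^sup>k\<close> for \<open>k \<le> t\<close>; in general \<open>E (X)\<^sub>k\<close> exceeds this value by a
  multiple of the squared deviation of the column pattern counts from uniformity.

  The polynomial \<open>f(X) (n - X)\<^sub>i\<close> with \<open>i \<ge> 1\<close> vanishes on all pairs. Writing \<open>f = \<Sum>\<^sub>j a\<^sub>j (X)\<^sub>j\<close> and
  taking expectations, the numbers \<open>b\<^sub>j = a\<^sub>j p\<^sup>j (n)\<^bsub>j+1\<^esub>\<close> on \<open>{0,\<dots>,s}\<close> annihilate all polynomials in
  \<open>j\<close> of degree at most \<open>s - 2\<close>, and on degree \<open>s - 1\<close> they see only the excess of the \<open>2s\<close>-th moment.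
  Since \<open>a\<^sub>s = 1\<close>, \<open>a\<^bsub>s-1\<^esub> = s(s-1)/2 - \<Sum> x\<^sub>i\<close> and \<open>a\<^sub>0 = f(0)\<close>, testing against
  \<open>(j-1)\<cdots>(j-s+2)\<close> expresses the gap in the left inequality as a positive multiple of \<open>\<Prod> x\<^sub>i\<close>, and
  testing against \<open>j(j-1)\<cdots>(j-s+2)\<close> expresses the gap in the right one as a positive multiple of the
  excess. If the excess is zero, all \<open>b\<^sub>j\<close> are determined up to scaling, and \<open>E f(X) = f(n) / N\<close> yields \<open>N\<close>.
  The argument needs \<open>2s \<le> n\<close>; otherwise \<open>C\<close> is the whole space, \<open>s = n\<close>, and both bounds are attained.
\<close>

section \<open>Falling factorials and expansion in their basis\<close>

definition falling :: "real \<Rightarrow> nat \<Rightarrow> real" where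
  "falling x k = (\<Prod>l<k. x - real l)"

lemma falling_0 [simp]: "falling x 0 = 1"
  by (simp add: falling_def)

lemma falling_Suc: "falling x (Suc k) = falling x k * (x - real k)"
  by (simp add: falling_def)

lemma falling_add: "falling x (j + i) = falling x j * falling (x - real j) i"
  by (induction i) (auto simp: falling_Suc algebra_simps)

lemma falling_Suc_left: "falling x (Suc k) = x * falling (x - 1) k"
  using falling_add[of x 1 k] by (simp add: falling_Suc)

lemma falling_of_nat: "falling (real m) k = fact k * real (m choose k)"
  by (simp add: falling_def binomial_gbinomial gbinomial_prod_rev atLeast0LessThan)

lemma falling_zero_left: "k > 0 \<Longrightarrow> falling 0 k = 0"
  by (cases k) (auto simp: falling_Suc_left)

lemma falling_of_nat_pos: "k \<le> m \<Longrightarrow> falling (real m) k > 0"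
  by (simp add: falling_of_nat)

text \<open>Write (X)_j for \<open>falling X j\<close>. Induction via (X - c) (X)_j = (X)_{j+1} + (j
  - c) (X)_j: a factor added to k earlier ones changes the second coefficient by k - c. The guard
  \<open>A \<noteq> {}\<close> excludes the case in which the truncated index
  \<open>card A - 1\<close> equals \<open>card A\<close>.\<close>

lemma prod_linear_falling_expansion:
  fixes c :: "'a \<Rightarrow> real"
  assumes "finite A"
  shows "\<exists>a. (\<forall>X. (\<Prod>l\<in>A. X - c l) = (\<Sum>j\<le>card A. a j * falling X j))
           \<and> a (card A) = 1
           \<and> (A \<noteq> {} \<longrightarrow> a (card A - 1) = real (card A) * (real (card A) - 1) / 2 - (\<Sum>l\<in>A. c l))"
  using assms
proof (induction A rule: finite_induct)
  case empty
  show ?case by (rule exI[of _ "\<lambda>_. 1"]) simp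
next
  case (insert u A)
  then obtain a where a: "\<And>X. (\<Prod>l\<in>A. X - c l) = (\<Sum>j\<le>card A. a j * falling X j)"
    "a (card A) = 1"
    "A \<noteq> {} \<Longrightarrow> a (card A - 1) = real (card A) * (real (card A) - 1) / 2 - (\<Sum>l\<in>A. c l)"
    by blast
  let ?k = "card A"
  \<comment> \<open>The first summand collects the raised terms, the second those of unchanged
    degree. \<open>a\<close> is arbitrary above \<open>?k\<close>, hence the cut-off.\<close>
  define a' where "a' j = (if j = 0 then 0 else a (j - 1)) + (if j \<le> ?k then (real j - c u) * a j else 0)" for j
  have card: "card (insert u A) = Suc ?k" using insert by simp
  have "(\<Prod>l\<in>insert u A. X - c l) = (\<Sum>j\<le>Suc ?k. a' j * falling X j)" for X
  proof -
    have "(\<Prod>l\<in>insert u A. X - c l) = (\<Sum>j\<le>?k. a j * falling X j) * (X - c u)"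
      using insert a(1) by (simp add: mult.commute)
    also have "\<dots> = (\<Sum>j\<le>?k. a j * falling X (Suc j) + (real j - c u) * a j * falling X j)"
      unfolding sum_distrib_right by (rule sum.cong) (auto simp: falling_Suc algebra_simps)
    also have "\<dots> = (\<Sum>j\<le>Suc ?k. (if j = 0 then 0 else a (j - 1)) * falling X j)
        + (\<Sum>j\<le>Suc ?k. (if j \<le> ?k then (real j - c u) * a j else 0) * falling X j)"
      by (subst sum.atMost_Suc_shift) (simp add: sum.distrib)
    also have "\<dots> = (\<Sum>j\<le>Suc ?k. a' j * falling X j)"
      by (simp add: a'_def sum.distrib algebra_simps)
    finally show ?thesis .
  qed
  moreover have "a' (Suc ?k) = 1" by (simp add: a'_def a)
  moreover have "a' ?k = real (Suc ?k) * (real (Suc ?k) - 1) / 2 - (\<Sum>l\<in>insert u A. c l)"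
  proof (cases "A = {}")
    case True
    then show ?thesis using a(2) by (simp add: a'_def)
  next
    case False
    then have "?k \<noteq> 0" using insert by simp
    then show ?thesis using a(2) a(3)[OF False] insert by (simp add: a'_def field_simps)
  qed
  ultimately show ?case
    unfolding card by (intro exI[of _ a']) (simp del: sum.atMost_Suc)
qed

section \<open>Binomial moments and functionals that annihilate low degrees\<close>

text \<open>Up to the sign, a product of linear factors in j is a monic polynomial in y - j; when
  the lower falling factorials are killed, only the leading one survives. This allows test
  polynomials to be chosen by their roots.\<close>

lemma annihilation_transfer:
  fixes b :: "nat \<Rightarrow> real" and c :: "'a \<Rightarrow> real"
  assumes "finite A"
    and "\<And>i. i < card A \<Longrightarrow> (\<Sum>j\<le>s. b j * falling (y - real j) i) = 0"
  shows "(\<Sum>j\<le>s. b j * (\<Prod>l\<in>A. real j - c l))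
       = (- 1) ^ card A * (\<Sum>j\<le>s. b j * falling (y - real j) (card A))"
proof -
  let ?k = "card A"
  obtain a where a: "\<And>X. (\<Prod>l\<in>A. X - (y - c l)) = (\<Sum>j\<le>?k. a j * falling X j)" "a ?k = 1"
    using prod_linear_falling_expansion[OF assms(1), of "\<lambda>l. y - c l"] by blast
  have "(\<Prod>l\<in>A. real j - c l) = (- 1) ^ ?k * (\<Prod>l\<in>A. (y - real j) - (y - c l))" for j
    by (simp add: prod.distrib[symmetric] flip: prod_constant)
  then have "(\<Sum>j\<le>s. b j * (\<Prod>l\<in>A. real j - c l))
      = (\<Sum>j\<le>s. \<Sum>i\<le>?k. (- 1) ^ ?k * a i * (b j * falling (y - real j) i))"
    unfolding a(1) by (simp add: sum_distrib_left mult_ac)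
  also have "\<dots> = (\<Sum>i\<le>?k. (- 1) ^ ?k * a i * (\<Sum>j\<le>s. b j * falling (y - real j) i))"
    by (subst sum.swap) (simp add: sum_distrib_left)
  also have "\<dots> = (- 1) ^ ?k * a ?k * (\<Sum>j\<le>s. b j * falling (y - real j) ?k)"
    by (subst lessThan_Suc_atMost[symmetric]) (simp add: assms(2))
  finally show ?thesis by (simp add: a(2))
qed

text \<open>The values are the mixed factorial moments of a binomial variable, scaled by
  \<open>W\<close>. The induction uses (X)_j (n - X - i) = (n - j - i) (X)_j - (X)_{j+1}; in each
  step the excess \<open>E\<close> enters only through the last term, which flips its sign.\<close>

lemma mixed_falling_moments:
  fixes X :: "'a \<Rightarrow> real"
  assumes low: "\<And>k. k \<le> t \<Longrightarrow> (\<Sum>v\<in>P. falling (X v) k) = W * falling n k * p ^ k"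
    and top: "(\<Sum>v\<in>P. falling (X v) (Suc t)) = W * falling n (Suc t) * p ^ Suc t + E"
    and "j + i \<le> Suc t"
  shows "(\<Sum>v\<in>P. falling (X v) j * falling (n - X v) i)
       = W * falling n (j + i) * p ^ j * (1 - p) ^ i + (if j + i = Suc t then (- 1) ^ i * E else 0)"
  using assms(3)
proof (induction i arbitrary: j)
  case 0
  then show ?case using low[of j] top by (cases "j = Suc t") auto
next
  case (Suc i)
  have "(\<Sum>v\<in>P. falling (X v) j * falling (n - X v) (Suc i))
      = (n - real (j + i)) * (\<Sum>v\<in>P. falling (X v) j * falling (n - X v) i)
        - (\<Sum>v\<in>P. falling (X v) (Suc j) * falling (n - X v) i)"
    unfolding sum_distrib_left sum_subtractf[symmetric]
    by (rule sum.cong) (auto simp: falling_Suc algebra_simps)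
  also have "\<dots> = (n - real (j + i)) * (W * falling n (j + i) * p ^ j * (1 - p) ^ i)
     - (W * falling n (Suc j + i) * p ^ Suc j * (1 - p) ^ i
        + (if Suc j + i = Suc t then (- 1) ^ i * E else 0))"
    using Suc.IH[of j] Suc.IH[of "Suc j"] Suc.prems by simp
  also have "\<dots> = W * falling n (j + Suc i) * p ^ j * (1 - p) ^ Suc i
     + (if j + Suc i = Suc t then (- 1) ^ Suc i * E else 0)"
    by (simp add: falling_Suc algebra_simps)
  finally show ?case .
qed

text \<open>Passing from s to s + 1 adds exactly the next term of the right side. The identity is
  needed at y = 1, where the value is 1, and at y = 1/p, which for p = 1/q gives the size of a tight
  design.\<close>

lemma truncated_binomial_sum:
  fixes y :: real
  assumes "s < n"
  shows "(\<Sum>j\<le>s. (- 1) ^ (s - j) * real (n choose j) * real ((n - 1 - j) choose (s - j)) * y ^ j)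
       = (\<Sum>k\<le>s. real (n choose k) * (y - 1) ^ k)"
  using assms
proof (induction s)
  case 0
  then show ?case by simp
next
  case (Suc s)
  let ?t = "\<lambda>s j. (- 1) ^ (s - j) * real (n choose j) * real ((n - 1 - j) choose (s - j)) * y ^ j"
  \<comment> \<open>Pascal's rule merges the two lower binomials into C(n-j, s+1-j), and C(n,j)
    C(n-j, s+1-j) = C(n, s+1) C(s+1, j).\<close>
  have step: "?t (Suc s) j + - ?t s j
      = real (n choose Suc s) * (real (Suc s choose j) * y ^ j * (- 1) ^ (Suc s - j))" if "j \<le> s" for j
  proof -
    have n: "n - j = Suc (n - 1 - j)" "Suc s - j = Suc (s - j)" using that Suc.prems by auto
    have "(n choose Suc s) * (Suc s choose j) = (n choose j) * ((n - j) choose (Suc s - j))"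
      using choose_mult[of j "Suc s" n] that Suc.prems by simp
    then have eq: "real (n choose Suc s) * real (Suc s choose j)
        = real (n choose j) * (real ((n - 1 - j) choose (s - j)) + real ((n - 1 - j) choose Suc (s - j)))"
      unfolding n binomial_Suc_Suc by (metis of_nat_add of_nat_mult)
    have "?t (Suc s) j + - ?t s j = (- 1) ^ Suc (s - j) * y ^ j * (real (n choose j)
        * (real ((n - 1 - j) choose (s - j)) + real ((n - 1 - j) choose Suc (s - j))))"
      unfolding n by (simp add: algebra_simps)
    then show ?thesis unfolding eq[symmetric] n by (simp add: mult_ac)
  qed
  have "(\<Sum>j\<le>Suc s. ?t (Suc s) j) - (\<Sum>j\<le>s. ?t s j)
      = (\<Sum>j\<le>s. ?t (Suc s) j + - ?t s j) + ?t (Suc s) (Suc s)"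
    by (simp add: sum_subtractf)
  also have "\<dots> = (\<Sum>j\<le>Suc s. real (n choose Suc s) * (real (Suc s choose j) * y ^ j * (- 1) ^ (Suc s - j)))"
    using step by simp
  also have "\<dots> = real (n choose Suc s) * (y + - 1) ^ Suc s"
    by (simp only: binomial_ring sum_distrib_left)
  finally show ?case using Suc by simp
qed

lemma sum_eq_sum_on_support:
  fixes g :: "'a \<Rightarrow> real"
  assumes "finite A" "B \<subseteq> A" "\<And>j. j \<in> A - B \<Longrightarrow> g j = 0"
  shows "sum g A = sum g B"
  using assms by (intro sum.mono_neutral_right) auto

text \<open>For s > 1 the polynomial (j-1)...(j-s+2) has degree s - 2, so it is annihilated, and on
  0..s it is nonzero only at 0, s - 1 and s. Up to the common factor (s-2)! its values there are
  (-1)^s, 1 and s - 1. For s = 1 the terms cancel outright.\<close>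

lemma three_term_annihilation:
  fixes b :: "nat \<Rightarrow> real"
  assumes "s \<ge> 1"
    and "\<And>i. Suc i < s \<Longrightarrow> (\<Sum>j\<le>s. b j * falling (y - real j) i) = 0"
  shows "(- 1) ^ s * b 0 + b (s - 1) + (real s - 1) * b s = 0"
proof (cases "s = 1")
  case True
  then show ?thesis by simp
next
  case False
  then obtain r where s: "s = r + 2"
    using assms(1) by (metis Suc_1 add.commute le_Suc_ex le_antisym not_less_eq_eq)
  define R where "R j = (\<Prod>l\<in>{1..r}. real j - real l)" for j
  have "(\<Sum>j\<le>s. b j * R j) = (\<Sum>j\<in>{0, r + 1, r + 2}. b j * R j)"
  proof (rule sum_eq_sum_on_support)
    fix j assume "j \<in> {..s} - {0, r + 1, r + 2}"
    then have "j \<in> {1..r}" using s by auto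
    then show "b j * R j = 0" unfolding R_def by (auto intro!: prod_zero)
  qed (use s in auto)
  moreover have "(\<Sum>j\<le>s. b j * R j) = 0"
    unfolding R_def
    using annihilation_transfer[where A = "{1..r}" and s = s and b = b and y = y and c = real] assms(2) s
    by auto
  ultimately have sum0: "b 0 * R 0 + b (r + 1) * R (r + 1) + b (r + 2) * R (r + 2) = 0"
    by simp
  have R0: "R 0 = (- 1) ^ r * fact r"
    by (simp add: R_def fact_prod prod_uminus)
  have R1: "R (r + 1) = fact r"
  proof -
    have "R (r + 1) = (\<Prod>l=1..r. real l)"
      unfolding R_def by (rule prod.reindex_bij_witness[of _ "\<lambda>l. r + 1 - l" "\<lambda>l. r + 1 - l"]) auto
    then show ?thesis by (simp add: fact_prod)
  qed
  have R2: "R (r + 2) = fact (r + 1)"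
  proof -
    have "R (r + 2) = (\<Prod>l=2..r+1. real l)"
      unfolding R_def by (rule prod.reindex_bij_witness[of _ "\<lambda>l. r + 2 - l" "\<lambda>l. r + 2 - l"]) auto
    also have "\<dots> = (\<Prod>l=1..r+1. real l)"
      by (subst (2) prod.atLeast_Suc_atMost) (simp_all add: numeral_2_eq_2)
    finally show ?thesis by (simp only: fact_prod of_nat_prod of_nat_id)
  qed
  have "fact r * ((- 1) ^ r * b 0 + b (r + 1) + (1 + real r) * b (r + 2)) = 0"
    using sum0 unfolding R0 R1 R2 by (simp add: algebra_simps)
  then show ?thesis using s by simp
qed

text \<open>The test polynomial (j)_{s-1} leaves only j = s - 1 and j = s. Its degree is the first
  beyond the annihilated ones, so the value of the functional there remains on the right.\<close>

lemma two_term_annihilation: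
  fixes b :: "nat \<Rightarrow> real"
  assumes "s \<ge> 1"
    and "\<And>i. Suc i < s \<Longrightarrow> (\<Sum>j\<le>s. b j * falling (y - real j) i) = 0"
  shows "fact (s - 1) * (b (s - 1) + real s * b s)
       = (- 1) ^ (s - 1) * (\<Sum>j\<le>s. b j * falling (y - real j) (s - 1))"
proof -
  obtain r where s: "s = Suc r" using assms(1) by (cases s) auto
  define R where "R j = (\<Prod>l<r. real j - real l)" for j
  have "(\<Sum>j\<le>s. b j * R j) = (\<Sum>j\<in>{r, Suc r}. b j * R j)"
  proof (rule sum_eq_sum_on_support)
    fix j assume "j \<in> {..s} - {r, Suc r}"
    then have "j \<in> {..<r}" using s by auto
    then show "b j * R j = 0" unfolding R_def by (auto intro!: prod_zero)
  qed (use s in auto)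
  moreover have "(\<Sum>j\<le>s. b j * R j) = (- 1) ^ r * (\<Sum>j\<le>s. b j * falling (y - real j) r)"
    unfolding R_def
    using annihilation_transfer[where A = "{..<r}" and s = s and b = b and y = y and c = real] assms(2) s
    by auto
  moreover have "R j = falling (real j) r" for j
    by (simp add: R_def falling_def)
  ultimately show ?thesis
    unfolding s by (simp add: falling_of_nat algebra_simps)
qed

text \<open>A functional on s + 1 consecutive points that kills all degrees below s is the s-th
  finite difference up to scale. The entries at k and s are compared by testing against the
  polynomial of degree s - 1 that vanishes at all other points.\<close>

lemma annihilator_eq_alternating_binomial:
  fixes b :: "nat \<Rightarrow> real"
  assumes "\<And>i. i < s \<Longrightarrow> (\<Sum>j\<le>s. b j * falling (y - real j) i) = 0"
    and "k \<le> s"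
  shows "b k = (- 1) ^ (s - k) * real (s choose k) * b s"
proof (cases "k = s")
  case True
  then show ?thesis by simp
next
  case False
  with assms(2) have ks: "k < s" by simp
  define A where "A = {..<s} - {k}"
  define R where "R j = (\<Prod>l\<in>A. real j - real l)" for j
  have cA: "finite A" "card A = s - 1" using ks by (auto simp: A_def)
  have "(\<Sum>j\<le>s. b j * R j) = (\<Sum>j\<in>{k, s}. b j * R j)"
  proof (rule sum_eq_sum_on_support)
    fix j assume "j \<in> {..s} - {k, s}"
    then have "j \<in> A" by (auto simp: A_def)
    then show "b j * R j = 0" unfolding R_def using cA by (auto intro!: prod_zero)
  qed (use ks in auto)
  moreover have "(\<Sum>j\<le>s. b j * R j) = 0"
    unfolding R_def
    using annihilation_transfer[where A = A and s = s and b = b and y = y and c = real] assms(1) cA ks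
    by auto
  ultimately have sum0: "b k * R k + b s * R s = 0"
    using ks by simp
  have "A = {..<k} \<union> {Suc k..<s}" using ks by (auto simp: A_def)
  then have "R k = (\<Prod>l<k. real k - real l) * (\<Prod>l=Suc k..<s. real k - real l)"
    unfolding R_def by (simp only:) (rule prod.union_disjoint, auto)
  also have "(\<Prod>l<k. real k - real l) = fact k"
    using falling_of_nat[of k k] by (simp add: falling_def)
  also have "(\<Prod>l=Suc k..<s. real k - real l) = (\<Prod>l=1..s - Suc k. - real l)"
    by (rule prod.reindex_bij_witness[of _ "\<lambda>l. l + k" "\<lambda>l. l - k"]) (use ks in auto)
  also have "\<dots> = (- 1) ^ (s - Suc k) * fact (s - Suc k)"
    by (simp add: prod_uminus fact_prod)
  finally have Rk: "R k = fact k * ((- 1) ^ (s - Suc k) * fact (s - Suc k))" .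
  \<comment> \<open>The factor s - k, absent from \<open>R s\<close> because k was removed from
    \<open>A\<close>, completes it to s!.\<close>
  have "R s * real (s - k) = (\<Prod>l<s. real s - real l)"
    unfolding R_def A_def using ks by (subst (2) prod.remove[of _ k]) (auto simp: of_nat_diff)
  also have "\<dots> = fact s"
    using falling_of_nat[of s s] by (simp add: falling_def)
  also have "\<dots> = fact k * fact (s - k) * real (s choose k)"
    using binomial_fact_lemma[OF assms(2)] by (metis of_nat_fact of_nat_mult)
  also have "\<dots> = (fact k * fact (s - Suc k) * real (s choose k)) * real (s - k)"
    using ks by (simp add: fact_reduce[of "s - k"])
  finally have Rs: "R s = fact k * fact (s - Suc k) * real (s choose k)"
    using ks by simp
  have sg: "(- 1 :: real) ^ (s - k) = - ((- 1) ^ (s - Suc k))"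
    using ks by (metis Suc_diff_Suc mult_minus1 power_Suc)
  have "fact k * fact (s - Suc k) * ((- 1) ^ (s - Suc k) * b k + real (s choose k) * b s) = 0"
    using sum0 unfolding Rk Rs by (simp add: algebra_simps)
  then have "(- 1) ^ (s - Suc k) * b k = - (real (s choose k) * b s)"
    by simp
  then have "(- 1) ^ (s - Suc k) * ((- 1) ^ (s - Suc k) * b k) = (- 1) ^ (s - Suc k) * (- (real (s choose k) * b s))"
    by simp
  then show ?thesis unfolding sg
    by (simp add: mult.assoc[symmetric] flip: power_mult_distrib)
qed

section \<open>Column patterns, agreements and the strength of a code\<close>

definition pattern_count :: "(nat \<Rightarrow> nat) set \<Rightarrow> nat set \<Rightarrow> (nat \<Rightarrow> nat) \<Rightarrow> nat" where
  "pattern_count C T z = card {c \<in> C. restrict c T = z}"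

definition agreement :: "nat \<Rightarrow> (nat \<Rightarrow> nat) \<Rightarrow> (nat \<Rightarrow> nat) \<Rightarrow> nat" where
  "agreement n x y = card {i \<in> {1..n}. x i = y i}"

text \<open>
  By the Cauchy-Schwarz defect identity this is, up to \<open>k!\<close>, the excess of the \<open>k\<close>-th factorial moment.
\<close>

definition nonuniformity :: "nat \<Rightarrow> nat \<Rightarrow> (nat \<Rightarrow> nat) set \<Rightarrow> nat \<Rightarrow> real" where
  "nonuniformity n q C k = (\<Sum>T | T \<subseteq> {1..n} \<and> card T = k. \<Sum>z \<in> T \<rightarrow>\<^sub>E {1..q}.
     (real (pattern_count C T z) - real (card C) / real q ^ k)\<^sup>2)"

lemma finite_hamming_words: "finite (hamming_words n q)"
  by (simp add: hamming_words_def finite_PiE)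

lemma finite_code: "C \<subseteq> hamming_words n q \<Longrightarrow> finite C"
  using finite_hamming_words finite_subset by blast

lemma finite_columns: "T \<subseteq> {1..n::nat} \<Longrightarrow> finite T"
  by (auto intro: finite_subset)

lemma agreement_plus_dist: "agreement n x y + hamming_dist n x y = n"
proof -
  have "agreement n x y + hamming_dist n x y
      = card ({i \<in> {1..n}. x i = y i} \<union> {i \<in> {1..n}. x i \<noteq> y i})"
    unfolding agreement_def hamming_dist_def by (rule card_Un_disjoint[symmetric]) auto
  also have "{i \<in> {1..n}. x i = y i} \<union> {i \<in> {1..n}. x i \<noteq> y i} = {1..n}" by auto
  finally show ?thesis by simp
qed

lemma agreement_set_alt: "agreement_set n C = {agreement n x y | x y. x \<in> C \<and> y \<in> C \<and> x \<noteq> y}"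
proof -
  have "n - hamming_dist n x y = agreement n x y" for x y
    using agreement_plus_dist[of n x y] by simp
  then show ?thesis unfolding agreement_set_def by simp
qed

lemma agreement_eq_iff:
  assumes "x \<in> hamming_words n q" "y \<in> hamming_words n q"
  shows "agreement n x y = n \<longleftrightarrow> x = y"
proof
  assume "agreement n x y = n"
  then have "{i \<in> {1..n}. x i = y i} = {1..n}"
    by (intro card_subset_eq) (auto simp: agreement_def)
  then have "\<And>i. i \<in> {1..n} \<Longrightarrow> x i = y i" by blast
  with assms show "x = y" unfolding hamming_words_def by (rule PiE_ext)
next
  assume "x = y"
  moreover have "{i. i \<in> {1..n}} = {1..n}" by auto
  ultimately show "agreement n x y = n" by (simp only: agreement_def card_atLeastAtMost simp_thms)
qed

lemma agreement_less:
  assumes "x \<in> hamming_words n q" "y \<in> hamming_words n q" "x \<noteq> y"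
  shows "agreement n x y < n"
  using agreement_eq_iff[OF assms(1,2)] agreement_plus_dist[of n x y] assms(3) by linarith

lemma restrict_in_PiE:
  assumes "c \<in> hamming_words n q" "T \<subseteq> {1..n}"
  shows "restrict c T \<in> T \<rightarrow>\<^sub>E {1..q}"
  using assms by (auto simp: hamming_words_def PiE_iff)

lemma sum_pattern_count:
  assumes "C \<subseteq> hamming_words n q" "T \<subseteq> {1..n}"
  shows "(\<Sum>z \<in> T \<rightarrow>\<^sub>E {1..q}. pattern_count C T z) = card C"
proof -
  have fin: "finite C" "finite T"
    using assms finite_code finite_columns by metis+
  have "card C = (\<Sum>c\<in>C. card {z \<in> T \<rightarrow>\<^sub>E {1..q}. restrict c T = z})"
  proof -
    have "{z \<in> T \<rightarrow>\<^sub>E {1..q}. restrict c T = z} = {restrict c T}" if "c \<in> C" for c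
      using restrict_in_PiE[OF subsetD[OF assms(1) that] assms(2)] by blast
    then show ?thesis by simp
  qed
  also have "\<dots> = (\<Sum>z \<in> T \<rightarrow>\<^sub>E {1..q}. pattern_count C T z)"
    unfolding pattern_count_def by (rule sum_multicount_gen[symmetric]) (use fin in \<open>auto intro: finite_PiE\<close>)
  finally show ?thesis ..
qed

text \<open>Agreeing pairs are classified by their common pattern on \<open>T\<close>; a pattern
  shared by m codewords yields m^2 ordered pairs, the diagonal included.\<close>

lemma card_agreeing_pairs:
  assumes "C \<subseteq> hamming_words n q" "T \<subseteq> {1..n}"
  shows "card {v \<in> C \<times> C. restrict (fst v) T = restrict (snd v) T}
       = (\<Sum>z \<in> T \<rightarrow>\<^sub>E {1..q}. (pattern_count C T z)\<^sup>2)"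
proof -
  have fin: "finite C" "finite T"
    using assms finite_code finite_columns by metis+
  have "{v \<in> C \<times> C. restrict (fst v) T = restrict (snd v) T}
      = (\<Union>z \<in> T \<rightarrow>\<^sub>E {1..q}. {c \<in> C. restrict c T = z} \<times> {c \<in> C. restrict c T = z})"
    using restrict_in_PiE[OF subsetD[OF assms(1)] assms(2)] by (auto simp del: restrict_PiE_iff)
  also have "card \<dots> = (\<Sum>z \<in> T \<rightarrow>\<^sub>E {1..q}. (pattern_count C T z)\<^sup>2)"
    by (subst card_UN_disjoint)
      (use fin in \<open>auto simp: pattern_count_def power2_eq_square card_cartesian_product intro!: finite_PiE\<close>)
  finally show ?thesis .
qed

text \<open>The q^k pattern counts have mean |C| / q^k, so this splits their second moment into
  squared mean and variance.\<close>

lemma sum_pattern_count_squares: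
  assumes "C \<subseteq> hamming_words n q" "T \<subseteq> {1..n}" "card T = k" "q \<ge> 1"
  shows "(\<Sum>z \<in> T \<rightarrow>\<^sub>E {1..q}. (real (pattern_count C T z))\<^sup>2)
       = (real (card C))\<^sup>2 / real q ^ k
         + (\<Sum>z \<in> T \<rightarrow>\<^sub>E {1..q}. (real (pattern_count C T z) - real (card C) / real q ^ k)\<^sup>2)"
proof -
  let ?N = "real (card C)" and ?Q = "real q ^ k" and ?Z = "T \<rightarrow>\<^sub>E {1..q}"
  have fin: "finite T" using assms(2) by (rule finite_columns)
  have cz: "real (card ?Z) = ?Q"
    using fin assms(3) by (simp add: card_PiE)
  have sm: "(\<Sum>z\<in>?Z. real (pattern_count C T z)) = ?N"
    using sum_pattern_count[OF assms(1,2)] by (metis of_nat_sum)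
  have "(\<Sum>z\<in>?Z. (real (pattern_count C T z) - ?N / ?Q)\<^sup>2)
      = (\<Sum>z\<in>?Z. (real (pattern_count C T z))\<^sup>2) - 2 * (?N / ?Q) * (\<Sum>z\<in>?Z. real (pattern_count C T z))
        + real (card ?Z) * (?N / ?Q)\<^sup>2"
    by (simp add: power2_diff sum.distrib sum_subtractf sum_distrib_left mult_ac)
  also have "\<dots> = (\<Sum>z\<in>?Z. (real (pattern_count C T z))\<^sup>2) - ?N\<^sup>2 / ?Q"
    unfolding sm cz using assms(4) by (simp add: power2_eq_square field_simps)
  finally show ?thesis by simp
qed

text \<open>Double counting of pairs of codewords against k-sets of columns on which they agree: a
  binomial coefficient of the agreement counts the sets for one pair, squared pattern counts count
  the pairs for one set. The factor k! turns binomials into falling factorials.\<close>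

lemma sum_falling_agreement:
  assumes "C \<subseteq> hamming_words n q" "q \<ge> 1"
  shows "(\<Sum>(x, y) \<in> C \<times> C. falling (real (agreement n x y)) k)
       = (real (card C))\<^sup>2 * falling (real n) k * (1 / real q) ^ k + fact k * nonuniformity n q C k"
proof -
  have fin: "finite C"
    using assms finite_code finite_columns by metis+
  let ?S = "{T. T \<subseteq> {1..n} \<and> card T = k}"
  have finS: "finite ?S" by simp
  have "(\<Sum>(x, y) \<in> C \<times> C. agreement n x y choose k)
      = (\<Sum>v \<in> C \<times> C. card {T \<in> ?S. restrict (fst v) T = restrict (snd v) T})"
  proof (rule sum.cong)
    fix v assume "v \<in> C \<times> C"
    obtain x y where v: "v = (x, y)" by fastforce
    have "{T \<in> ?S. restrict x T = restrict y T} = {T. T \<subseteq> {i \<in> {1..n}. x i = y i} \<and> card T = k}"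
      by (auto simp: restrict_def fun_eq_iff)
    then show "(case v of (x, y) \<Rightarrow> agreement n x y choose k)
        = card {T \<in> ?S. restrict (fst v) T = restrict (snd v) T}"
      using v by (simp add: n_subsets agreement_def)
  qed simp
  also have "\<dots> = (\<Sum>T\<in>?S. card {v \<in> C \<times> C. restrict (fst v) T = restrict (snd v) T})"
    by (rule sum_multicount_gen) (use fin finS in auto)
  also have "\<dots> = (\<Sum>T\<in>?S. \<Sum>z \<in> T \<rightarrow>\<^sub>E {1..q}. (pattern_count C T z)\<^sup>2)"
    by (rule sum.cong[OF refl]) (use card_agreeing_pairs[OF assms(1)] in blast)
  finally have "(\<Sum>(x, y) \<in> C \<times> C. real (agreement n x y choose k))
      = (\<Sum>T\<in>?S. \<Sum>z \<in> T \<rightarrow>\<^sub>E {1..q}. (real (pattern_count C T z))\<^sup>2)"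
    by (simp add: case_prod_beta flip: of_nat_sum of_nat_power)
  also have "\<dots> = (\<Sum>T\<in>?S. (real (card C))\<^sup>2 / real q ^ k
         + (\<Sum>z \<in> T \<rightarrow>\<^sub>E {1..q}. (real (pattern_count C T z) - real (card C) / real q ^ k)\<^sup>2))"
    by (rule sum.cong) (use sum_pattern_count_squares[OF assms(1) _ _ assms(2)] in auto)
  also have "\<dots> = real (n choose k) * ((real (card C))\<^sup>2 / real q ^ k) + nonuniformity n q C k"
    by (simp add: sum.distrib nonuniformity_def n_subsets)
  finally show ?thesis
    by (simp add: falling_of_nat case_prod_beta field_simps flip: sum_distrib_left)
qed

lemma nonuniformity_nonneg: "nonuniformity n q C k \<ge> 0"
  unfolding nonuniformity_def by (intro sum_nonneg) auto

lemma nonuniformity_eq_0_iff: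
  "nonuniformity n q C k = 0 \<longleftrightarrow>
     (\<forall>T z. T \<subseteq> {1..n} \<and> card T = k \<and> z \<in> T \<rightarrow>\<^sub>E {1..q} \<longrightarrow>
        real (pattern_count C T z) = real (card C) / real q ^ k)"
proof -
  have fin: "finite (T \<rightarrow>\<^sub>E {1..q})" if "T \<subseteq> {1..n}" for T
    using finite_columns[OF that] by (auto intro: finite_PiE)
  have "nonuniformity n q C k = 0 \<longleftrightarrow>
     (\<forall>T \<in> {T. T \<subseteq> {1..n} \<and> card T = k}. (\<Sum>z \<in> T \<rightarrow>\<^sub>E {1..q}.
        (real (pattern_count C T z) - real (card C) / real q ^ k)\<^sup>2) = 0)"
    unfolding nonuniformity_def by (rule sum_nonneg_eq_0_iff) (auto intro: sum_nonneg)
  also have "\<dots> \<longleftrightarrow> (\<forall>T \<in> {T. T \<subseteq> {1..n} \<and> card T = k}. \<forall>z \<in> T \<rightarrow>\<^sub>E {1..q}.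
        (real (pattern_count C T z) - real (card C) / real q ^ k)\<^sup>2 = 0)"
    by (intro ball_cong refl sum_nonneg_eq_0_iff fin) auto
  finally show ?thesis by auto
qed

text \<open>If the pattern counts on \<open>T\<close> are constant, summing them over all patterns
  forces the constant to be their mean, so the deviations vanish.\<close>

lemma hamming_design_iff_nonuniformity:
  assumes "C \<noteq> {}" "C \<subseteq> hamming_words n q" "q \<ge> 1"
  shows "hamming_design t n q C \<longleftrightarrow> nonuniformity n q C (min t n) = 0"
proof
  assume "nonuniformity n q C (min t n) = 0"
  then have eq: "real (pattern_count C T z) = real (card C) / real q ^ min t n"
    if "T \<subseteq> {1..n}" "card T = min t n" "z \<in> T \<rightarrow>\<^sub>E {1..q}" for T z
    using that unfolding nonuniformity_eq_0_iff by blast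
  have "\<exists>m. \<forall>z \<in> T \<rightarrow>\<^sub>E {1..q}. pattern_count C T z = m"
    if "T \<subseteq> {1..n}" "card T = min t n" for T
    using eq[OF that] by (metis of_nat_eq_iff)
  then show "hamming_design t n q C"
    unfolding hamming_design_def pattern_count_def using assms by blast
next
  assume "hamming_design t n q C"
  then have ex: "\<exists>m. \<forall>z \<in> T \<rightarrow>\<^sub>E {1..q}. pattern_count C T z = m"
    if "T \<subseteq> {1..n}" "card T = min t n" for T
    using that unfolding hamming_design_def pattern_count_def by blast
  show "nonuniformity n q C (min t n) = 0"
    unfolding nonuniformity_eq_0_iff
  proof (intro allI impI, elim conjE)
    fix T z assume T: "T \<subseteq> {1..n}" "card T = min t n" and z: "z \<in> T \<rightarrow>\<^sub>E {1..q}"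
    obtain m where m: "\<And>z. z \<in> T \<rightarrow>\<^sub>E {1..q} \<Longrightarrow> pattern_count C T z = m"
      using ex[OF T] by blast
    have "finite T" using T(1) by (rule finite_columns)
    then have "card C = q ^ min t n * m"
      using sum_pattern_count[OF assms(2) T(1)] m T(2) by (simp add: card_PiE)
    then show "real (pattern_count C T z) = real (card C) / real q ^ min t n"
      using m[OF z] assms(3) by simp
  qed
qed

text \<open>Since k < n, some column lies outside \<open>T\<close>. Its letter splits a pattern on
  \<open>T\<close> into q patterns on k + 1 columns, each occurring |C| / q^(k+1) times.\<close>

lemma nonuniformity_Suc_imp:
  assumes "C \<subseteq> hamming_words n q" "q \<ge> 1" "k < n" "nonuniformity n q C (Suc k) = 0"
  shows "nonuniformity n q C k = 0"
  unfolding nonuniformity_eq_0_iff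
proof (intro allI impI, elim conjE)
  fix T z assume T: "T \<subseteq> {1..n}" "card T = k" and z: "z \<in> T \<rightarrow>\<^sub>E {1..q}"
  have fin: "finite C" "finite T"
    using assms(1) T(1) finite_code finite_columns by metis+
  obtain i where i: "i \<in> {1..n}" "i \<notin> T"
    using T assms(3) by (metis card_atLeastAtMost diff_Suc_1 less_irrefl subsetI subset_antisym)
  have "{c \<in> C. restrict c T = z} = (\<Union>v\<in>{1..q}. {c \<in> C. restrict c (insert i T) = z(i := v)})"
  proof (intro equalityI subsetI)
    fix c assume c: "c \<in> {c \<in> C. restrict c T = z}"
    then have "restrict c (insert i T) = z(i := c i)" by (auto simp: restrict_def fun_eq_iff)
    moreover have "c i \<in> {1..q}" using c assms(1) i(1) unfolding hamming_words_def by (blast dest: PiE_mem)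
    ultimately show "c \<in> (\<Union>v\<in>{1..q}. {c \<in> C. restrict c (insert i T) = z(i := v)})"
      using c by blast
  next
    fix c assume "c \<in> (\<Union>v\<in>{1..q}. {c \<in> C. restrict c (insert i T) = z(i := v)})"
    then obtain v where c: "c \<in> C" "restrict c (insert i T) = z(i := v)" by blast
    have "restrict c T j = z j" for j
      using fun_cong[OF c(2), of j] i z by (cases "j \<in> T") (auto split: if_splits)
    then show "c \<in> {c \<in> C. restrict c T = z}" using c by auto
  qed
  moreover have "{c \<in> C. restrict c (insert i T) = z(i := v)} \<inter> {c \<in> C. restrict c (insert i T) = z(i := w)} = {}"
    if "v \<noteq> w" for v w
    using that by (auto dest: fun_cong[of _ _ i])
  ultimately have "pattern_count C T z = (\<Sum>v\<in>{1..q}. pattern_count C (insert i T) (z(i := v)))"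
    unfolding pattern_count_def using fin by (simp add: card_UN_disjoint)
  moreover have "real (pattern_count C (insert i T) (z(i := v))) = real (card C) / real q ^ Suc k"
    if "v \<in> {1..q}" for v
    using assms(4) that i T fin z unfolding nonuniformity_eq_0_iff
    by (metis PiE_fun_upd card_insert_disjoint insert_subset)
  ultimately show "real (pattern_count C T z) = real (card C) / real q ^ k"
    using assms(2) by simp
qed

lemma nonuniformity_antimono:
  assumes "C \<subseteq> hamming_words n q" "q \<ge> 1" "k \<le> t" "t \<le> n" "nonuniformity n q C t = 0"
  shows "nonuniformity n q C k = 0"
  using assms(3,4,5)
proof (induction rule: inc_induct)
  case base
  then show ?case by simp
next
  case (step m)
  then show ?case using nonuniformity_Suc_imp[OF assms(1,2), of m] by simp
qed

text \<open>On all n columns a pattern is a whole word, so every word occurs with the positive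
  frequency |C| / q^n.\<close>

lemma complete_design:
  assumes "C \<noteq> {}" "C \<subseteq> hamming_words n q" "q \<ge> 1" "nonuniformity n q C n = 0"
  shows "C = hamming_words n q"
proof (intro equalityI subsetI)
  fix z assume z: "z \<in> hamming_words n q"
  have "finite C" using assms(2) by (rule finite_code)
  moreover have "real (pattern_count C {1..n} z) = real (card C) / real q ^ n"
    using assms(4) z unfolding nonuniformity_eq_0_iff hamming_words_def by auto
  ultimately have "pattern_count C {1..n} z \<noteq> 0"
    using assms by auto
  then obtain c where c: "c \<in> C" "restrict c {1..n} = z"
    unfolding pattern_count_def by (metis (mono_tags, lifting) card.empty empty_Collect_eq)
  moreover have "restrict c {1..n} = c"
    using c(1) assms(2) unfolding hamming_words_def by (meson PiE_restrict subsetD)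
  ultimately show "z \<in> C" by simp
qed (use assms in auto)

lemma agreement_set_hamming_words:
  assumes "q \<ge> 2"
  shows "agreement_set n (hamming_words n q) = {..<n}"
proof (intro equalityI subsetI)
  fix k assume "k \<in> agreement_set n (hamming_words n q)"
  then show "k \<in> {..<n}" unfolding agreement_set_alt using agreement_less by auto
next
  fix k assume k: "k \<in> {..<n}"
  \<comment> \<open>The two words agree exactly in the first k columns; q \<ge> 2 provides the
    second letter.\<close>
  define x where "x = restrict (\<lambda>_. 1::nat) {1..n}"
  define y where "y = restrict (\<lambda>i. if i \<le> k then 1 else (2::nat)) {1..n}"
  have "x \<in> hamming_words n q" "y \<in> hamming_words n q"
    using assms by (auto simp: x_def y_def hamming_words_def)
  moreover have "{i \<in> {1..n}. x i = y i} = {1..k}"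
    using k by (auto simp: x_def y_def split: if_splits)
  then have "agreement n x y = k" by (simp add: agreement_def)
  moreover have "x \<noteq> y"
    using calculation k agreement_eq_iff[of x n q y] by auto
  ultimately show "k \<in> agreement_set n (hamming_words n q)"
    unfolding agreement_set_alt by blast
qed

section \<open>Moment identities for the roots\<close>

text \<open>With f the product over the roots, f(X) (y - X)_{i+1} vanishes on \<open>P\<close>: f
  handles the roots, and the extra factor y - X handles the points with X = y. Expanding f and
  inserting the mixed moments gives the relation after division by W (1-p)^(i+1).\<close>

lemma root_coefficients_annihilate:
  fixes X :: "'a \<Rightarrow> real" and x :: "nat \<Rightarrow> real"
  assumes roots: "\<And>v. v \<in> P \<Longrightarrow> X v = y \<or> X v \<in> x ` {1..s}"
    and low: "\<And>k. k < 2 * s \<Longrightarrow> (\<Sum>v\<in>P. falling (X v) k) = W * falling y k * p ^ k"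
    and top: "(\<Sum>v\<in>P. falling (X v) (2 * s)) = W * falling y (2 * s) * p ^ (2 * s) + E"
    and a: "\<And>z. (\<Prod>i=1..s. z - x i) = (\<Sum>j\<le>s. a j * falling z j)" "a s = 1"
    and "W \<noteq> 0" "p \<noteq> 1" "i < s"
  shows "(\<Sum>j\<le>s. (a j * p ^ j * falling y (Suc j)) * falling (y - 1 - real j) i)
       = (if Suc i = s then - ((- 1) ^ s * E) / (W * (1 - p) ^ s) else 0)"
proof -
  let ?M = "\<Sum>j\<le>s. (a j * p ^ j * falling y (Suc j)) * falling (y - 1 - real j) i"
  have mix: "(\<Sum>v\<in>P. falling (X v) j * falling (y - X v) (Suc i))
      = W * falling y (j + Suc i) * p ^ j * (1 - p) ^ Suc i
        + (if j + Suc i = 2 * s then (- 1) ^ Suc i * E else 0)" if "j \<le> s" for j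
    using mixed_falling_moments[where t = "2 * s - 1" and P = P and X = X and W = W and n = y and p = p
        and E = E and j = j and i = "Suc i"] low top that assms(8) by simp
  \<comment> \<open>The first j + 1 factors go into the weight; what remains is a test polynomial of
    degree i in j.\<close>
  have split: "falling y (j + Suc i) = falling y (Suc j) * falling (y - 1 - real j) i" for j
    using falling_add[of y "Suc j" i] by (simp add: algebra_simps)
  have "0 = (\<Sum>v\<in>P. (\<Prod>i=1..s. X v - x i) * falling (y - X v) (Suc i))"
  proof (rule sum.neutral[symmetric], rule ballI)
    fix v assume "v \<in> P"
    with roots[of v] consider "X v = y" | l where "l \<in> {1..s}" "X v = x l" by blast
    then show "(\<Prod>i=1..s. X v - x i) * falling (y - X v) (Suc i) = 0"
    proof cases
      case 1
      then show ?thesis by (simp add: falling_zero_left)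
    next
      case 2
      then have "(\<Prod>i=1..s. X v - x i) = 0" by (auto intro!: prod_zero)
      then show ?thesis by simp
    qed
  qed
  also have "\<dots> = (\<Sum>v\<in>P. \<Sum>j\<le>s. a j * (falling (X v) j * falling (y - X v) (Suc i)))"
    unfolding a(1) sum_distrib_right by (simp add: mult.assoc)
  also have "\<dots> = (\<Sum>j\<le>s. a j * (\<Sum>v\<in>P. falling (X v) j * falling (y - X v) (Suc i)))"
    by (subst sum.swap) (simp add: sum_distrib_left)
  also have "\<dots> = (\<Sum>j\<le>s. W * (1 - p) ^ Suc i * ((a j * p ^ j * falling y (Suc j)) * falling (y - 1 - real j) i)
        + a j * (if j + Suc i = 2 * s then (- 1) ^ Suc i * E else 0))"
  proof (rule sum.cong[OF refl])
    fix j assume "j \<in> {..s}"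
    then show "a j * (\<Sum>v\<in>P. falling (X v) j * falling (y - X v) (Suc i))
        = W * (1 - p) ^ Suc i * ((a j * p ^ j * falling y (Suc j)) * falling (y - 1 - real j) i)
          + a j * (if j + Suc i = 2 * s then (- 1) ^ Suc i * E else 0)"
      using mix[of j] unfolding split by (simp only: atMost_iff distrib_left mult_ac)
  qed
  also have "\<dots> = W * (1 - p) ^ Suc i * ?M
        + (\<Sum>j\<le>s. a j * (if j + Suc i = 2 * s then (- 1) ^ Suc i * E else 0))"
    by (simp only: sum.distrib sum_distrib_left)
  \<comment> \<open>As j \<le> s and i < s, the order j + i + 1 reaches 2s only for j = s and i = s
    - 1, where the coefficient is \<open>a s = 1\<close>.\<close>
  also have "(\<Sum>j\<le>s. a j * (if j + Suc i = 2 * s then (- 1) ^ Suc i * E else 0))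
      = (\<Sum>j\<le>s. if j = s then (if Suc i = s then (- 1) ^ s * E else 0) else 0)"
    by (rule sum.cong) (use assms(8) a(2) in auto)
  also have "\<dots> = (if Suc i = s then (- 1) ^ s * E else 0)"
    by simp
  finally have "W * (1 - p) ^ Suc i * ?M + (if Suc i = s then (- 1) ^ s * E else 0) = 0" ..
  then have "?M = - (if Suc i = s then (- 1) ^ s * E else 0) / (W * (1 - p) ^ Suc i)"
    using assms(6,7) by (simp add: field_simps)
  then show ?thesis by (auto split: if_splits)
qed

text \<open>The weights \<open>b 0\<close> and \<open>b (s - 1)\<close> carry the product and the
  sum of the roots, so the three-term and two-term relations turn into the first two formulas. The
  third evaluates the sum of f(X) over \<open>P\<close> in two ways. The bound 2s \<le> n keeps
  (n)_s and (n)_{s+1} positive.\<close>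

lemma root_sum_identities:
  fixes X :: "'a \<Rightarrow> real" and x :: "nat \<Rightarrow> real" and n :: nat
  assumes roots: "\<And>v. v \<in> P \<Longrightarrow> X v = real n \<or> X v \<in> x ` {1..s}"
    and low: "\<And>k. k < 2 * s \<Longrightarrow> (\<Sum>v\<in>P. falling (X v) k) = W * falling (real n) k * p ^ k"
    and top: "(\<Sum>v\<in>P. falling (X v) (2 * s)) = W * falling (real n) (2 * s) * p ^ (2 * s) + E"
    and W: "W \<noteq> 0" and p: "0 < p" "p < 1" and s: "1 \<le> s" and n: "2 * s \<le> n"
  shows "(\<Sum>i=1..s. x i) = (real s - 1) * (real n - real s) * p + real s * (real s - 1) / 2
           + real n / (p ^ (s - 1) * falling (real n) s) * (\<Prod>i=1..s. x i)" (is ?lower)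
    and "(\<Sum>i=1..s. x i) = real s * (real n - real s) * p + real s * (real s - 1) / 2
           - E / (W * (1 - p) ^ s * fact (s - 1) * p ^ (s - 1) * falling (real n) s)" (is ?upper)
    and "E = 0 \<Longrightarrow> finite P \<Longrightarrow>
           W = real (card {v \<in> P. X v = real n}) * (\<Sum>k\<le>s. real (n choose k) * (1 / p - 1) ^ k)"
proof -
  let ?n = "real n"
  obtain a where a: "\<And>z. (\<Prod>i=1..s. z - x i) = (\<Sum>j\<le>s. a j * falling z j)" "a s = 1"
    "a (s - 1) = real s * (real s - 1) / 2 - (\<Sum>i=1..s. x i)"
    using prod_linear_falling_expansion[of "{1..s}" x] s by auto
  define b where "b j = a j * p ^ j * falling ?n (Suc j)" for j
  have M: "(\<Sum>j\<le>s. b j * falling (?n - 1 - real j) i)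
       = (if Suc i = s then - ((- 1) ^ s * E) / (W * (1 - p) ^ s) else 0)" if "i < s" for i
    unfolding b_def using root_coefficients_annihilate[OF roots low top a(1,2) W _ that] p by simp
  have pos: "falling ?n s > 0" "p ^ (s - 1) > 0"
    using n p by (auto intro: falling_of_nat_pos)
  have "(\<Prod>i=1..s. 0 - x i) = (\<Sum>j\<in>{0}. a j * falling 0 j)"
    unfolding a(1) by (rule sum_eq_sum_on_support) (auto simp: falling_zero_left)
  then have "a 0 = (- 1) ^ s * (\<Prod>i=1..s. x i)"
    by (simp add: prod_uminus)
  then have b0: "(- 1) ^ s * b 0 = ?n * (\<Prod>i=1..s. x i)"
    by (simp add: b_def falling_Suc mult.assoc[symmetric] flip: power_mult_distrib)
  \<comment> \<open>Both \<open>b (s - 1)\<close> and \<open>b s\<close> contain the factor p^(s-1)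
    (n)_s, which is divided out below as \<open>?K\<close>.\<close>
  have bs1: "b (s - 1) = a (s - 1) * (p ^ (s - 1) * falling ?n s)"
    using s by (simp add: b_def)
  have bs: "b s = (?n - real s) * p * (p ^ (s - 1) * falling ?n s)"
    using s a(2) by (simp add: b_def falling_Suc power_eq_if)
  let ?K = "p ^ (s - 1) * falling ?n s"
  have K: "?K > 0" using pos by simp
  have linear_solve: "v = - (u / k)" if "u + k * v = 0" "k > 0" for u k v :: real
    using that by (simp add: field_simps add_eq_0_iff2)
  have "(- 1) ^ s * b 0 + b (s - 1) + (real s - 1) * b s = 0"
    by (rule three_term_annihilation[where y = "?n - 1", OF s]) (use M in auto)
  then have "?n * (\<Prod>i=1..s. x i) + ?K * (a (s - 1) + (real s - 1) * (?n - real s) * p) = 0"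
    unfolding b0 bs1 bs by (simp add: algebra_simps)
  then have "a (s - 1) + (real s - 1) * (?n - real s) * p = - (?n / ?K * (\<Prod>i=1..s. x i))"
    using linear_solve[OF _ K] by simp
  then show ?lower unfolding a(3) by simp
  have product_solve: "v = e / (fact m * k)" if "fact m * (k * v) = e" "k > 0" for e k v :: real and m
    using that by (simp add: field_simps)
  have "fact (s - 1) * (b (s - 1) + real s * b s) = (- 1) ^ (s - 1) * (- ((- 1) ^ s * E) / (W * (1 - p) ^ s))"
    using two_term_annihilation[where y = "?n - 1" and b = b, OF s] M s by simp
  also have "\<dots> = E / (W * (1 - p) ^ s)"
    using s by (cases s) (simp_all add: mult.assoc[symmetric] flip: power_mult_distrib)
  finally have "fact (s - 1) * (?K * (a (s - 1) + real s * (?n - real s) * p)) = E / (W * (1 - p) ^ s)"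
    unfolding bs1 bs by (simp add: algebra_simps)
  then have "a (s - 1) + real s * (?n - real s) * p = E / (W * (1 - p) ^ s) / (fact (s - 1) * ?K)"
    by (rule product_solve[OF _ K])
  then show ?upper unfolding a(3) by (simp add: mult_ac)
  assume E: "E = 0" and fin: "finite P"
  \<comment> \<open>\<open>?g\<close> lists the coefficients of the truncated binomial sum, and
    \<open>?c\<close> is the scale left free by annihilation; it does not depend on j.\<close>
  let ?g = "\<lambda>j. (- 1) ^ (s - j) * real (n choose j) * real ((n - 1 - j) choose (s - j))"
  let ?c = "b s * fact s / falling ?n (Suc s)"
  have quotient_solve: "u = c / k * g" if "u * m * k = c * g * m" "m > 0" "k > 0" for u c k g m :: real
    using that by (simp add: field_simps)
  have d: "a j * falling ?n j * p ^ j = ?c * ?g j" if "j \<le> s" for j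
  proof -
    have bj: "b j = (- 1) ^ (s - j) * real (s choose j) * b s"
      by (rule annihilator_eq_alternating_binomial[where y = "?n - 1"]) (use M E that in auto)
    have "Suc s = j + Suc (s - j)" using that by simp
    then have "falling ?n (Suc s) = falling ?n j * ((?n - real j) * falling (?n - real j - 1) (s - j))"
      by (simp only: falling_add falling_Suc_left)
    also have "?n - real j - 1 = real (n - 1 - j)"
      using that n s by (simp add: of_nat_diff)
    finally have F: "falling ?n (Suc s)
        = fact j * fact (s - j) * (?n - real j) * (real (n choose j) * real ((n - 1 - j) choose (s - j)))"
      by (simp add: falling_of_nat)
    have S: "fact s = fact j * fact (s - j) * real (s choose j)"
      using binomial_fact_lemma[OF that] by (metis of_nat_fact of_nat_mult)
    have nj: "?n - real j > 0" using that n s by simp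
    have F0: "falling ?n (Suc s) > 0" using n s by (intro falling_of_nat_pos) simp
    have "(a j * falling ?n j * p ^ j) * (?n - real j) = b j"
      by (simp add: b_def falling_Suc)
    also have "\<dots> * falling ?n (Suc s) = b s * fact s * ?g j * (?n - real j)"
      unfolding bj F S by simp
    finally show ?thesis by (rule quotient_solve[OF _ nj F0])
  qed
  have c: "?c \<noteq> 0"
    using falling_of_nat_pos[of "Suc s" n] pos n s p unfolding bs by simp
  have s_less: "s < n" using n s by simp
  \<comment> \<open>Only points with X = n contribute to the sum of f(X). By the moments this sum is
    \<open>W * ?c\<close> times the truncated sum at y = 1, while f(n) is \<open>?c\<close> times
    that sum at y = 1/p; finally \<open>?c\<close> cancels.\<close>
  have "real (card {v \<in> P. X v = ?n}) * (\<Prod>i=1..s. ?n - x i) = (\<Sum>v\<in>{v \<in> P. X v = ?n}. \<Prod>i=1..s. X v - x i)"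
    by simp
  also have "\<dots> = (\<Sum>v\<in>P. \<Prod>i=1..s. X v - x i)"
  proof (rule sum_eq_sum_on_support[symmetric, OF fin])
    fix v assume "v \<in> P - {v \<in> P. X v = ?n}"
    then obtain l where "l \<in> {1..s}" "X v = x l" using roots[of v] by blast
    then show "(\<Prod>i=1..s. X v - x i) = 0" by (auto intro!: prod_zero)
  qed auto
  also have "\<dots> = (\<Sum>j\<le>s. a j * (\<Sum>v\<in>P. falling (X v) j))"
    unfolding a(1) by (subst sum.swap) (simp add: sum_distrib_left)
  also have "\<dots> = (\<Sum>j\<le>s. W * (a j * falling ?n j * p ^ j))"
    by (rule sum.cong) (use low s in auto)
  also have "\<dots> = W * ?c * (\<Sum>j\<le>s. ?g j * 1 ^ j)"
    unfolding sum_distrib_left by (rule sum.cong) (use d in auto)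
  also have "(\<Sum>j\<le>s. ?g j * 1 ^ j) = (\<Sum>k\<in>{0}. real (n choose k) * (1 - 1) ^ k)"
    unfolding truncated_binomial_sum[OF s_less] by (rule sum_eq_sum_on_support) auto
  also have "\<dots> = 1" by simp
  also have "(\<Prod>i=1..s. ?n - x i) = (\<Sum>j\<le>s. a j * falling ?n j * p ^ j * (1 / p) ^ j)"
    unfolding a(1) using p by (intro sum.cong) (auto simp: power_divide)
  also have "\<dots> = ?c * (\<Sum>j\<le>s. ?g j * (1 / p) ^ j)"
    unfolding sum_distrib_left by (rule sum.cong) (use d in auto)
  finally have "?c * (real (card {v \<in> P. X v = ?n}) * (\<Sum>k\<le>s. real (n choose k) * (1 / p - 1) ^ k)) = ?c * W"
    unfolding truncated_binomial_sum[OF s_less] by (simp add: mult_ac)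
  then show "W = real (card {v \<in> P. X v = real n}) * (\<Sum>k\<le>s. real (n choose k) * (1 / p - 1) ^ k)"
    using c by simp
qed

section \<open>The sum of the agreement numbers of a code\<close>

lemma strict_mono_on_first_eq_0_iff:
  fixes x :: "nat \<Rightarrow> nat"
  assumes "s \<ge> 1" "strict_mono_on {1..s} x"
  shows "x 1 = 0 \<longleftrightarrow> 0 \<in> x ` {1..s}"
proof
  assume "0 \<in> x ` {1..s}"
  then obtain i where i: "i \<in> {1..s}" "x i = 0" by auto
  show "x 1 = 0"
  proof (cases "i = 1")
    case False
    then have "x 1 < x i" using i assms(1) by (intro strict_mono_onD[OF assms(2)]) auto
    then show ?thesis using i by simp
  qed (use i in simp)
qed (use assms(1) in force)

text \<open>The strength covers all n columns, so \<open>C\<close> is the whole space. Its agreement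
  numbers are 0..n-1, whence s = n, and its size q^n is the tight one by the binomial
  theorem.\<close>

lemma agreement_sum_of_large_strength:
  fixes n q s :: nat and C :: "(nat \<Rightarrow> nat) set" and x :: "nat \<Rightarrow> nat"
  assumes n: "n \<le> 2 * s - 1" and q: "q \<ge> 2" and s: "s \<ge> 1"
    and C: "C \<subseteq> hamming_words n q"
    and design: "hamming_design (2 * s - 1) n q C"
    and agreements: "agreement_set n C = x ` {1..s}"
    and mono: "strict_mono_on {1..s} x"
  shows "s = n" "(\<Sum>i=1..s. real (x i)) = real s * (real s - 1) / 2" "x ` {1..s} = {..<n}"
    "tight_even_design s n q C"
proof -
  have q1: "q \<ge> 1" using q by simp
  have ne: "C \<noteq> {}" using design by (simp add: hamming_design_def)
  have unif: "nonuniformity n q C (min (2 * s - 1) n) = 0"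
    using design hamming_design_iff_nonuniformity[OF ne C q1] by simp
  have inj: "inj_on x {1..s}" using mono by (rule strict_mono_on_imp_inj_on)
  have V: "nonuniformity n q C n = 0" using unif n by (simp add: min_absorb2)
  have full: "C = hamming_words n q" by (rule complete_design[OF ne C q1 V])
  have im: "x ` {1..s} = {..<n}"
    using agreements agreement_set_hamming_words[OF q] unfolding full by simp
  have sn: "s = n" using card_image[OF inj] im by simp
  have "(\<Sum>i=1..s. real (x i)) = (\<Sum>k<n. real k)"
    using sum.reindex[OF inj, of real] im by simp
  also have "\<dots> = real n * (real n - 1) / 2"
    by (induction n) (auto simp: field_simps)
  finally have sum: "(\<Sum>i=1..s. real (x i)) = real s * (real s - 1) / 2" using sn by simp
  have "hamming_design (2 * s) n q C"
    using V sn hamming_design_iff_nonuniformity[OF ne C q1] by simp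
  moreover have "card C = (\<Sum>k = 0..s. (n choose k) * (q - 1) ^ k)"
  proof -
    have "card C = ((q - 1) + 1) ^ n" unfolding full hamming_words_def using q by (simp add: card_PiE)
    also have "\<dots> = (\<Sum>k\<le>n. (n choose k) * (q - 1) ^ k)" by (subst binomial) simp
    finally show ?thesis using sn by (simp add: atMost_atLeast0)
  qed
  ultimately have tight: "tight_even_design s n q C" unfolding tight_even_design_def by simp
  show "s = n" "(\<Sum>i=1..s. real (x i)) = real s * (real s - 1) / 2" "x ` {1..s} = {..<n}"
    "tight_even_design s n q C"
    by (fact sn sum im tight)+
qed

text \<open>The moment identities are applied to all ordered pairs of codewords, with W = |C|^2, p =
  1/q and the excess (2s)! times the nonuniformity on 2s columns. The gap \<open>u\<close> is a
  positive multiple of the product of the roots, and \<open>v\<close> one of that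
  nonuniformity.\<close>

lemma agreement_sum_gaps:
  fixes n q s :: nat and C :: "(nat \<Rightarrow> nat) set" and x :: "nat \<Rightarrow> nat"
  assumes n: "2 * s \<le> n" and q: "q \<ge> 2" and s: "s \<ge> 1"
    and C: "C \<subseteq> hamming_words n q"
    and design: "hamming_design (2 * s - 1) n q C"
    and agreements: "agreement_set n C = x ` {1..s}"
    and mono: "strict_mono_on {1..s} x"
  shows "\<exists>u v. u \<ge> 0 \<and> v \<ge> 0
    \<and> (\<Sum>i=1..s. real (x i)) = (real s - 1) * (real n - real s) / real q + real s * (real s - 1) / 2 + u
    \<and> (\<Sum>i=1..s. real (x i)) = real s * (real n - real s) / real q + real s * (real s - 1) / 2 - v
    \<and> (u = 0 \<longleftrightarrow> x 1 = 0) \<and> (v = 0 \<longleftrightarrow> tight_even_design s n q C)"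
proof -
  have q1: "q \<ge> 1" using q by simp
  have ne: "C \<noteq> {}" using design by (simp add: hamming_design_def)
  have fin: "finite C" using C by (rule finite_code)
  have unif: "nonuniformity n q C (min (2 * s - 1) n) = 0"
    using design hamming_design_iff_nonuniformity[OF ne C q1] by simp
  define N where "N = real (card C)"
  define X where "X v = real (agreement n (fst v) (snd v))" for v
  define V where "V = nonuniformity n q C (2 * s)"
  define p where "p = 1 / real q"
  have N: "N > 0" using ne fin by (simp add: N_def card_gt_0_iff)
  have p: "0 < p" "p < 1" using q by (auto simp: p_def)
  have Xn: "X (c, d) = real n \<longleftrightarrow> c = d" if "c \<in> C" "d \<in> C" for c d
    using agreement_eq_iff[of c n q d] that C by (auto simp: X_def)
  have roots: "X v = real n \<or> X v \<in> (\<lambda>i. real (x i)) ` {1..s}" if v: "v \<in> C \<times> C" for v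
  proof (cases "fst v = snd v")
    case True
    then show ?thesis using Xn[of "fst v" "snd v"] v by auto
  next
    case False
    then have "agreement n (fst v) (snd v) \<in> agreement_set n C"
      unfolding agreement_set_alt using v by force
    then show ?thesis unfolding agreements X_def by auto
  qed
  have moments: "(\<Sum>v\<in>C \<times> C. falling (X v) k)
      = N\<^sup>2 * falling (real n) k * p ^ k + fact k * nonuniformity n q C k" for k
    using sum_falling_agreement[OF C q1, of k] by (simp add: X_def N_def p_def case_prod_beta)
  have low: "(\<Sum>v\<in>C \<times> C. falling (X v) k) = N\<^sup>2 * falling (real n) k * p ^ k" if "k < 2 * s" for k
    unfolding moments using nonuniformity_antimono[OF C q1 _ _ unif, of k] that n by simp
  have N2: "N\<^sup>2 \<noteq> 0" using N by simp
  note ids = root_sum_identities[OF roots low moments[of "2 * s"] N2 p s n, folded V_def]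
  let ?S = "\<Sum>i=1..s. real (x i)"
  have Fpos: "falling (real n) s > 0" using n by (intro falling_of_nat_pos) simp
  define K where "K = real n / (p ^ (s - 1) * falling (real n) s)"
  define L where "L = fact (2 * s) / (N\<^sup>2 * (1 - p) ^ s * fact (s - 1) * p ^ (s - 1) * falling (real n) s)"
  have K: "K > 0" unfolding K_def using p Fpos s n by simp
  have L: "L > 0" unfolding L_def using p Fpos N by simp
  have lower: "?S = (real s - 1) * (real n - real s) / real q + real s * (real s - 1) / 2
      + K * (\<Prod>i=1..s. real (x i))"
    using ids(1) by (simp add: K_def p_def)
  have upper: "?S = real s * (real n - real s) / real q + real s * (real s - 1) / 2 - L * V"
    using ids(2) by (simp add: L_def p_def)
  have V0: "V \<ge> 0" unfolding V_def by (rule nonuniformity_nonneg)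
  have prod0: "(\<Prod>i=1..s. real (x i)) = 0 \<longleftrightarrow> x 1 = 0"
    unfolding strict_mono_on_first_eq_0_iff[OF s mono] by (auto simp: prod_zero_iff image_iff)
  have des: "hamming_design (2 * s) n q C \<longleftrightarrow> V = 0"
    using hamming_design_iff_nonuniformity[OF ne C q1, of "2 * s"] n by (simp add: V_def min_absorb1)
  \<comment> \<open>The value n is attained exactly on the diagonal, which has N pairs, so the third
    identity reads N^2 = N times the tight size.\<close>
  have size: "card C = (\<Sum>k = 0..s. (n choose k) * (q - 1) ^ k)" if "V = 0"
  proof -
    have "{v \<in> C \<times> C. X v = real n} = (\<lambda>c. (c, c)) ` C"
      using Xn by auto
    then have "real (card {v \<in> C \<times> C. X v = real n}) = N"
      by (simp add: N_def card_image inj_on_def)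
    then have "N\<^sup>2 = N * (\<Sum>k\<le>s. real (n choose k) * (real q - 1) ^ k)"
      using ids(3) that fin by (simp add: p_def)
    then have "N = (\<Sum>k\<le>s. real (n choose k) * (real q - 1) ^ k)"
      using N by (simp add: power2_eq_square)
    also have "\<dots> = real (\<Sum>k = 0..s. (n choose k) * (q - 1) ^ k)"
      using q1 by (simp add: of_nat_diff atMost_atLeast0)
    finally show ?thesis unfolding N_def of_nat_eq_iff .
  qed
  have K0: "K * (\<Prod>i=1..s. real (x i)) \<ge> 0"
    using K by (intro mult_nonneg_nonneg prod_nonneg) simp_all
  have L0: "L * V \<ge> 0" using L V0 by simp
  have K_iff: "K * (\<Prod>i=1..s. real (x i)) = 0 \<longleftrightarrow> x 1 = 0"
    unfolding prod0[symmetric] using K by (simp only: mult_eq_0_iff) simp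
  have L_iff: "L * V = 0 \<longleftrightarrow> tight_even_design s n q C"
    unfolding tight_even_design_def des using L size by force
  show ?thesis
    by (rule exI[of _ "K * (\<Prod>i=1..s. real (x i))"], rule exI[of _ "L * V"])
      (intro conjI K0 L0 lower upper K_iff L_iff)
qed

theorem theorem4p1:
  fixes n q s :: nat and C :: "(nat \<Rightarrow> nat) set" and x :: "nat \<Rightarrow> nat"
  assumes "n \<ge> 1" and "q \<ge> 2" and "s \<ge> 1"
    and "C \<subseteq> hamming_words n q"
    and "hamming_design (2 * s - 1) n q C"
    and "code_degree n C = s"
    and "agreement_set n C = x ` {1..s}"
    and "strict_mono_on {1..s} x"
  shows "(real s - 1) * (real n - real s) / real q + real s * (real s - 1) / 2
           \<le> (\<Sum>i = 1..s. real (x i))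
       \<and> (\<Sum>i = 1..s. real (x i))
           \<le> real s * (real n - real s) / real q + real s * (real s - 1) / 2
       \<and> ((real s - 1) * (real n - real s) / real q + real s * (real s - 1) / 2
             = (\<Sum>i = 1..s. real (x i)) \<longleftrightarrow> x 1 = 0)
       \<and> ((\<Sum>i = 1..s. real (x i))
             = real s * (real n - real s) / real q + real s * (real s - 1) / 2
           \<longleftrightarrow> tight_even_design s n q C)"
proof (cases "n \<le> 2 * s - 1")
  case True
  note large = agreement_sum_of_large_strength[OF True assms(2-5,7,8)]
  \<comment> \<open>Here s = n, so both bounds collapse to s(s-1)/2, and the agreement numbers
    0..n-1 start at 0.\<close>
  have "x 1 = 0"
    unfolding strict_mono_on_first_eq_0_iff[OF assms(3,8)] large(3) using assms(1) by simp
  with large show ?thesis by simp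
next
  case False
  then have "2 * s \<le> n" by simp
  from agreement_sum_gaps[OF this assms(2-5,7,8)] obtain u v :: real
    where uv: "u \<ge> 0" "v \<ge> 0"
      and sums: "(\<Sum>i=1..s. real (x i)) = (real s - 1) * (real n - real s) / real q + real s * (real s - 1) / 2 + u"
      "(\<Sum>i=1..s. real (x i)) = real s * (real n - real s) / real q + real s * (real s - 1) / 2 - v"
      and iffs: "u = 0 \<longleftrightarrow> x 1 = 0" "v = 0 \<longleftrightarrow> tight_even_design s n q C"
    by (elim exE conjE) (rule that)
  have sandwich: "A \<le> S \<and> S \<le> B \<and> (A = S \<longleftrightarrow> u = 0) \<and> (S = B \<longleftrightarrow> v = 0)"
    if "S = A + u" "S = B - v" for A B S :: real
    using that uv by (intro conjI iffI) simp_all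
  show ?thesis
    using sandwich[OF sums] unfolding iffs .
qed

end
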